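(* Let $n\ge2$ and $N\ge1$. The map $\mathcal K_N:\Delta^N\to\mathfrak D(N,n)$, $\mathcal K_N(\lambda)=D^N_\lambda$, is a bijection.
   Context: Weights of $\mathfrak o_{2n}(\mathbb C)$ are written as $n$-tuples in the standard basis, with positive roots $h_i^*\pm h_j^*$ ($i<j$); $P_+$ is the set of dominant integral weights: $n$-tuples with all entries in $\mathbb Z$ or all in $\frac12+\mathbb Z$ and $\lambda_1\ge\dots\ge\lambda_{n-1}\ge|\lambda_n|$. $P[S]=\{(\pm\frac12,\dots,\pm\frac12)\}$ is the set of weights of the spinor representation $S$. $T^N$ is the set of $(\mu_1,\dots,\mu_N)\in P[S]^N$ with $\mu_1=(\frac12,\dots,\frac12,\pm\frac12)$ and $\sum_{i\le k}\mu_i\in P_+$ for all $k\le N$, and $\Delta^N=\{\sum_{i=1}^N\mu_i:(\mu_1,\dots,\mu_N)\in T^N\}$ (the set of highest weights of irreducible subrepresentations of $S^{\otimes N}$). A regular cell diagram $D(\mathbf l,\mathbf r)$ of length $N$ and height $n$ is determined by two $n$-tuples of non-negative integers $\mathbf l=(l_i)$, $\mathbf r=(r_i)$ with $r_i+l_i=N$ for all $i$, $r_1\ge r_2\ge\dots\ge r_n$ and $r_{n-1}\ge l_n$ (row $i$ has $r_i$ cells to the right and $l_i$ cells to the left of a vertical axis). $\mathfrak D(N,n)$ is the set of such diagrams. For $\lambda\in\Delta^N$, $D^N_\lambda=D(\mathbf l,\mathbf r)$ with $r_i=\frac N2+\lambda_i$ and $l_i=\frac N2-\lambda_i$. *)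

theory Defs
  imports Complex_Main
begin

text \<open>
  Weights of \<open>\<oo>\<^sub>2\<^sub>n(\<complex>)\<close> are lists of length \<open>n\<close> over the reals; the coordinate written
  \<open>\<lambda>\<^sub>i\<close> with \<open>1 \<le> i \<le> n\<close> is the list entry with index \<open>i - 1\<close>. Below \<open>n \<ge> 2\<close> is always intended.
\<close>

type_synonym weight = "real list"

definition dominant_weights :: "nat \<Rightarrow> weight set" where
  "dominant_weights n = {w. length w = n \<and>
     ((\<forall>i<n. w ! i \<in> \<int>) \<or> (\<forall>i<n. w ! i - 1/2 \<in> \<int>)) \<and>
     (\<forall>i. i + 2 < n \<longrightarrow> w ! i \<ge> w ! (i + 1)) \<and>
     w ! (n - 2) \<ge> \<bar>w ! (n - 1)\<bar>}"

definition spinor_weights :: "nat \<Rightarrow> weight set" where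
  "spinor_weights n = {\<mu>. length \<mu> = n \<and> (\<forall>i<n. \<mu> ! i = 1/2 \<or> \<mu> ! i = - 1/2)}"

definition partial_sum :: "nat \<Rightarrow> weight list \<Rightarrow> nat \<Rightarrow> weight" where
  "partial_sum n \<mu>s k = map (\<lambda>i. \<Sum>j<k. \<mu>s ! j ! i) [0..<n]"

definition spinor_paths :: "nat \<Rightarrow> nat \<Rightarrow> weight list set" where
  "spinor_paths n N = {\<mu>s. length \<mu>s = N \<and> set \<mu>s \<subseteq> spinor_weights n \<and>
     (\<mu>s ! 0 = replicate (n - 1) (1/2) @ [1/2] \<or> \<mu>s ! 0 = replicate (n - 1) (1/2) @ [- 1/2]) \<and>
     (\<forall>k\<in>{1..N}. partial_sum n \<mu>s k \<in> dominant_weights n)}"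

definition path_weights :: "nat \<Rightarrow> nat \<Rightarrow> weight set" where
  "path_weights n N = {partial_sum n \<mu>s N | \<mu>s. \<mu>s \<in> spinor_paths n N}"

text \<open>
  \<open>Diagram l r\<close> is \<open>D(l, r)\<close>. The row lengths have type \<open>real\<close> so that \<open>N/2 \<plusminus> \<lambda>\<^sub>i\<close> can be
  used without rounding or truncation; that they are natural numbers is part of the
  definition of \<open>regular_diagrams\<close>.
\<close>

datatype cell_diagram = Diagram (left_cells: "real list") (right_cells: "real list")

definition regular_diagrams :: "nat \<Rightarrow> nat \<Rightarrow> cell_diagram set" where
  "regular_diagrams N n = {Diagram l r | l r.
     length l = n \<and> length r = n \<and> set l \<subseteq> \<nat> \<and> set r \<subseteq> \<nat> \<and>
     (\<forall>i<n. r ! i + l ! i = real N) \<and>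
     (\<forall>i. i + 1 < n \<longrightarrow> r ! i \<ge> r ! (i + 1)) \<and>
     r ! (n - 2) \<ge> l ! (n - 1)}"

definition weight_diagram :: "nat \<Rightarrow> weight \<Rightarrow> cell_diagram" where
  "weight_diagram N w =
     Diagram (map (\<lambda>x. real N / 2 - x) w) (map (\<lambda>x. real N / 2 + x) w)"

end

theory Submission
  imports Defs
begin

text \<open>
  In the coordinates \<open>r\<^sub>i = N/2 + \<lambda>\<^sub>i\<close> a path adds at each step a cell to the right or to the left
  of the axis in every row, so \<open>r\<^sub>i\<close> counts the steps with entry \<open>+1/2\<close> in row \<open>i\<close>. Conversely, a
  regular diagram is reached by filling the right-hand cells of every row first: after \<open>k\<close> steps
  row \<open>i\<close> has \<open>min k r\<^sub>i\<close> cells on the right, which is monotone in \<open>i\<close>, and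
  \<open>min k r\<^sub>n\<^sub>-\<^sub>1 + min k r\<^sub>n \<ge> k\<close> because \<open>r\<^sub>n\<^sub>-\<^sub>1 + r\<^sub>n \<ge> N \<ge> k\<close>.
\<close>

lemma length_partial_sum [simp]: "length (partial_sum n \<mu>s k) = n"
  by (simp add: partial_sum_def)

lemma nth_partial_sum [simp]: "i < n \<Longrightarrow> partial_sum n \<mu>s k ! i = (\<Sum>j<k. \<mu>s ! j ! i)"
  by (simp add: partial_sum_def)

text \<open>\<open>m\<close> is the number of steps \<open>j < k\<close> with entry 1/2 in row
  \<open>i\<close>; the other \<open>k - m\<close> steps contribute -1/2 each.\<close>

lemma spinor_sum_eq_count:
  assumes "set \<mu>s \<subseteq> spinor_weights n" "i < n" "k \<le> length \<mu>s"
  shows "\<exists>m\<le>k. (\<Sum>j<k. \<mu>s ! j ! i) = real m - real k / 2"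
  using assms(3)
proof (induction k)
  case 0
  then show ?case by simp
next
  case (Suc k)
  then obtain m where m: "m \<le> k" "(\<Sum>j<k. \<mu>s ! j ! i) = real m - real k / 2"
    by auto
  have "\<mu>s ! k \<in> spinor_weights n"
    using Suc.prems assms(1) nth_mem[of k \<mu>s] by auto
  then consider "\<mu>s ! k ! i = 1/2" | "\<mu>s ! k ! i = - 1/2"
    using assms(2) by (auto simp: spinor_weights_def)
  then show ?case
  proof cases
    case 1
    then show ?thesis using m by (intro exI[of _ "Suc m"]) (simp add: field_simps)
  next
    case 2
    then show ?thesis using m by (intro exI[of _ m]) (simp add: field_simps)
  qed
qed

lemma sum_half_signs:
  "(\<Sum>j<k. if j < m then 1/2 else - 1/2 :: real) = real (min k m) - real k / 2"
  by (induction k) (auto simp: min_def field_simps)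

text \<open>All entries are congruent to \<open>- k / 2\<close> modulo 1, so the parity of
  \<open>k\<close> decides between integers and half-integers. The bound \<open>last\<close> says
  that the final two entries have non-negative sum, which together with \<open>mono\<close> gives
  the absolute value condition. It serves both for partial sums of a path and for the weight of a
  diagram.\<close>

lemma count_dominant:
  assumes n: "n \<ge> 2" and len: "length w = n"
    and w: "\<And>i. i < n \<Longrightarrow> w ! i = real (R i) - real k / 2"
    and mono: "\<And>i. i + 1 < n \<Longrightarrow> R (i + 1) \<le> R i"
    and last: "k \<le> R (n - 2) + R (n - 1)"
  shows "w \<in> dominant_weights n"
proof -
  have "(\<forall>i<n. w ! i \<in> \<int>) \<or> (\<forall>i<n. w ! i - 1/2 \<in> \<int>)"
  proof (cases "even k")
    case True
    then obtain c where "k = 2 * c" by blast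
    then show ?thesis using w by auto
  next
    case False
    then obtain c where c: "k = 2 * c + 1" by (blast elim: oddE)
    have "w ! i - 1/2 \<in> \<int>" if "i < n" for i
    proof -
      have "w ! i - 1/2 = of_int (int (R i) - int c - 1)"
        using w[OF that] c by (simp add: field_simps)
      then show ?thesis by (metis Ints_of_int)
    qed
    then show ?thesis by blast
  qed
  moreover have "w ! (i + 1) \<le> w ! i" if "i + 2 < n" for i
    using w[of i] w[of "i + 1"] mono[of i] that by simp
  moreover have "\<bar>w ! (n - 1)\<bar> \<le> w ! (n - 2)"
  proof -
    have "R (n - 1) \<le> R (n - 2)" using mono[of "n - 2"] n by (simp add: numeral_2_eq_2 Suc_diff_Suc)
    moreover have "real k \<le> real (R (n - 2)) + real (R (n - 1))"
      using last by (metis of_nat_add of_nat_le_iff)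
    ultimately show ?thesis using w[of "n - 1"] w[of "n - 2"] n by (simp add: abs_le_iff)
  qed
  ultimately show ?thesis using len by (simp add: dominant_weights_def)
qed

text \<open>The descent into the last coordinate is hidden in the condition on
  \<open>\<bar>w ! (n - 1)\<bar>\<close>.\<close>

lemma dominant_weights_mono:
  assumes "w \<in> dominant_weights n" "i + 1 < n"
  shows "w ! (i + 1) \<le> w ! i"
proof (cases "i + 2 < n")
  case True
  then show ?thesis using assms by (simp add: dominant_weights_def)
next
  case False
  then have "i = n - 2" "i + 1 = n - 1" using assms(2) by auto
  then show ?thesis using assms(1) by (auto simp: dominant_weights_def)
qed

text \<open>This eliminates the paths: counting steps gives one inclusion, filling the right-hand
  cells first gives the other. Comparing weights with diagrams is then a matter of
  inequalities.\<close>

lemma path_weights_eq: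
  assumes n: "n \<ge> 2" and N: "N \<ge> 1"
  shows "path_weights n N =
    {w \<in> dominant_weights n. \<forall>i<n. \<exists>m\<le>N. w ! i = real m - real N / 2}" (is "_ = ?W")
proof
  show "path_weights n N \<subseteq> ?W"
    using N spinor_sum_eq_count by (auto simp: path_weights_def spinor_paths_def)
next
  show "?W \<subseteq> path_weights n N"
  proof
    fix w assume "w \<in> ?W"
    then have dom: "w \<in> dominant_weights n" and "\<forall>i<n. \<exists>m\<le>N. w ! i = real m - real N / 2"
      by auto
    then obtain R where RN: "\<And>i. i < n \<Longrightarrow> R i \<le> N"
      and w: "\<And>i. i < n \<Longrightarrow> w ! i = real (R i) - real N / 2"
      by metis
    have len: "length w = n" using dom by (simp add: dominant_weights_def)
    have decr: "R (i + 1) \<le> R i" if "i + 1 < n" for i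
      using dominant_weights_mono[OF dom that] w[of i] w[of "i + 1"] that by simp
    have anti: "R j \<le> R i" if "i \<le> j" "j < n" for i j
      using that
    proof (induction j rule: dec_induct)
      case (step m)
      then show ?case using decr[of m] by simp
    qed simp
    have "- (w ! (n - 1)) \<le> w ! (n - 2)" using dom by (auto simp: dominant_weights_def)
    then have "real N \<le> real (R (n - 2) + R (n - 1))"
      using w[of "n - 1"] w[of "n - 2"] n by simp
    then have last: "N \<le> R (n - 2) + R (n - 1)" by (simp only: of_nat_le_iff)
    \<comment> \<open>The larger of two numbers with sum at least \<open>N \<ge> 1\<close> is
      positive, so the path built below starts with 1/2 in every row except possibly the
      last.\<close>
    have "R (n - 1) \<le> R (n - 2)" using anti[of "n - 2" "n - 1"] n by simp
    then have pos: "R i > 0" if "i < n - 1" for i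
      using last N anti[of i "n - 2"] that by linarith

    define \<mu>s where "\<mu>s = map (\<lambda>j. map (\<lambda>i. if j < R i then 1/2 else - 1/2 :: real) [0..<n]) [0..<N]"
    have psum: "partial_sum n \<mu>s k ! i = real (min k (R i)) - real k / 2" if "k \<le> N" "i < n" for k i
    proof -
      have "(\<Sum>j<k. \<mu>s ! j ! i) = (\<Sum>j<k. if j < R i then 1/2 else - 1/2)"
        by (rule sum.cong) (use that in \<open>auto simp: \<mu>s_def\<close>)
      then show ?thesis using that by (simp add: sum_half_signs)
    qed
    have "set \<mu>s \<subseteq> spinor_weights n" by (auto simp: \<mu>s_def spinor_weights_def split: if_splits)
    moreover have "\<mu>s ! 0 = replicate (n - 1) (1/2) @ [if 0 < R (n - 1) then 1/2 else - 1/2]"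
    proof (rule nth_equalityI)
      show "length (\<mu>s ! 0) = length (replicate (n - 1) (1/2) @ [if 0 < R (n - 1) then 1/2 else - 1/2 :: real])"
        using n N by (simp add: \<mu>s_def)
      fix i assume "i < length (\<mu>s ! 0)"
      then have i: "i < n" using N by (simp add: \<mu>s_def)
      show "\<mu>s ! 0 ! i = (replicate (n - 1) (1/2) @ [if 0 < R (n - 1) then 1/2 else - 1/2]) ! i"
      proof (cases "i < n - 1")
        case True
        then show ?thesis using pos[of i] i N by (simp add: \<mu>s_def nth_append)
      next
        case False
        then have "i = n - 1" using i by simp
        then show ?thesis using i N by (simp add: \<mu>s_def nth_append)
      qed
    qed
    moreover have "partial_sum n \<mu>s k \<in> dominant_weights n" if "k \<in> {1..N}" for k
    proof (rule count_dominant[where R = "\<lambda>i. min k (R i)" and k = k])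
      show "min k (R (i + 1)) \<le> min k (R i)" if "i + 1 < n" for i
        using decr[OF that] by auto
      \<comment> \<open>If one minimum is \<open>k\<close> this is clear; otherwise the sum is
        \<open>R (n - 2) + R (n - 1) \<ge> N \<ge> k\<close>.\<close>
      show "k \<le> min k (R (n - 2)) + min k (R (n - 1))"
        using last that by (auto simp: min_def)
    qed (use n that psum in auto)
    ultimately have "\<mu>s \<in> spinor_paths n N"
      by (auto simp: spinor_paths_def \<mu>s_def)
    moreover have "w = partial_sum n \<mu>s N"
    proof (rule nth_equalityI)
      show "length w = length (partial_sum n \<mu>s N)" using len by simp
      show "w ! i = partial_sum n \<mu>s N ! i" if "i < length w" for i
        using psum[of N i] w[of i] RN[of i] that len by (simp del: nth_partial_sum add: min_absorb2)
    qed
    ultimately show "w \<in> path_weights n N" by (auto simp: path_weights_def)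
  qed
qed

text \<open>The right half alone is a translate of the weight and determines it.\<close>

lemma inj_weight_diagram: "inj (weight_diagram N)"
proof (rule injI)
  fix v w assume "weight_diagram N v = weight_diagram N w"
  then have "map (\<lambda>x. real N / 2 + x) v = map (\<lambda>x. real N / 2 + x) w"
    by (simp add: weight_diagram_def)
  then show "v = w" by (rule map_injective) (simp add: inj_def)
qed

theorem proposition4p7:
  fixes n N :: nat
  assumes "n \<ge> 2" and "N \<ge> 1"
  shows "bij_betw (weight_diagram N) (path_weights n N) (regular_diagrams N n)"
  unfolding bij_betw_def
proof
  show "inj_on (weight_diagram N) (path_weights n N)"
    using inj_weight_diagram by (rule inj_on_subset) simp
  show "weight_diagram N ` path_weights n N = regular_diagrams N n"
  proof (intro equalityI subsetI)
    fix D assume "D \<in> weight_diagram N ` path_weights n N"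
    then obtain w where D: "D = weight_diagram N w" and dom: "w \<in> dominant_weights n"
      and cnt: "\<forall>i<n. \<exists>m\<le>N. w ! i = real m - real N / 2"
      unfolding path_weights_eq[OF assms] by blast
    have len: "length w = n" using dom by (simp add: dominant_weights_def)
    have nats: "real N / 2 - x \<in> \<nat> \<and> real N / 2 + x \<in> \<nat>" if "x \<in> set w" for x
    proof -
      from that obtain i where "i < n" "x = w ! i" using len by (metis in_set_conv_nth)
      then obtain m where m: "m \<le> N" "x = real m - real N / 2" using cnt by blast
      then have "real N / 2 - x = real (N - m)" "real N / 2 + x = real m"
        by (simp_all add: of_nat_diff)
      then show ?thesis by (metis of_nat_in_Nats)
    qed
    \<comment> \<open>After adding \<open>N / 2\<close> to both sides this is the diagram condition
      relating the last two rows.\<close>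
    have "- (w ! (n - 1)) \<le> w ! (n - 2)" using dom by (auto simp: dominant_weights_def)
    then show "D \<in> regular_diagrams N n"
      using nats len dominant_weights_mono[OF dom] assms(1)
      by (auto simp: D weight_diagram_def regular_diagrams_def)
  next
    fix D assume "D \<in> regular_diagrams N n"
    then obtain l r where D: "D = Diagram l r" and len: "length l = n" "length r = n"
      and nats: "set l \<subseteq> \<nat>" "set r \<subseteq> \<nat>"
      and sum: "\<And>i. i < n \<Longrightarrow> r ! i + l ! i = real N"
      and mono: "\<And>i. i + 1 < n \<Longrightarrow> r ! (i + 1) \<le> r ! i"
      and last: "l ! (n - 1) \<le> r ! (n - 2)"
      unfolding regular_diagrams_def by blast
    have "\<exists>m\<le>N. r ! i = real m" if "i < n" for i
    proof -
      have "r ! i \<in> \<nat>" "l ! i \<in> \<nat>" using nats len that by (metis nth_mem subsetD)+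
      then obtain a b where "r ! i = real a" "l ! i = real b" by (auto elim!: Nats_cases)
      then show ?thesis using sum[OF that] by (intro exI[of _ a]) simp
    qed
    then obtain R where RN: "\<And>i. i < n \<Longrightarrow> R i \<le> N" and R: "\<And>i. i < n \<Longrightarrow> r ! i = real (R i)"
      by metis
    \<comment> \<open>The preimage is read off from the right half; the left half is recovered at
      the end from the constant row length \<open>N\<close>.\<close>
    define w where "w = map (\<lambda>x. x - real N / 2) r"
    have w: "w ! i = real (R i) - real N / 2" if "i < n" for i
      using that len R by (simp add: w_def)
    have "w \<in> dominant_weights n"
    proof (rule count_dominant[OF assms(1) _ w])
      show "R (i + 1) \<le> R i" if "i + 1 < n" for i
        using mono[OF that] R[of i] R[of "i + 1"] that by simp
      \<comment> \<open>Substituting \<open>l ! (n - 1) = N - r ! (n - 1)\<close> into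
        \<open>last\<close> gives the bound required with \<open>k = N\<close>.\<close>
      have "real N \<le> real (R (n - 2) + R (n - 1))"
        using last sum[of "n - 1"] R[of "n - 1"] R[of "n - 2"] assms(1) by simp
      then show "N \<le> R (n - 2) + R (n - 1)" by (simp only: of_nat_le_iff)
    qed (simp_all add: w_def len)
    then have "w \<in> path_weights n N"
      unfolding path_weights_eq[OF assms] using w RN by blast
    moreover have "D = weight_diagram N w"
    proof -
      have "l ! i = real N - r ! i" if "i < n" for i using sum[OF that] by simp
      then have "l = map (\<lambda>x. real N - x) r" using len by (intro nth_equalityI) auto
      then show ?thesis by (simp add: D weight_diagram_def w_def o_def)
    qed
    ultimately show "D \<in> weight_diagram N ` path_weights n N" by blast
  qed
qed

end
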